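(* Let $l\in\mathbb Z$. If $(f_n)\subset L_2$ is a sequence satisfying $M(f_n)<H(f_n)=l$ for all $n$ and $m(f_n)\to-\infty$ as $n\to\infty$, then $\mathfrak r^{+,f_n}\to\mathfrak s^l$ in $\partial_h L_2$. Similarly, if $(f_n)\subset L_2$ is a sequence satisfying $m(f_n)\ge H(f_n)=l$ for all $n$ and $M(f_n)\to\infty$ as $n\to\infty$, then $\mathfrak r^{-,f_n}\to\mathfrak s^l$ in $\partial_h L_2$.
   Context: Lamplighter group: $L_2=\langle a,t\mid a^2,\ [a^{t^i},a^{t^j}]\ \forall i,j\in\mathbb Z\rangle\cong(\bigoplus_{\mathbb Z}\mathbb Z/2)\rtimes\mathbb Z$. Each element is identified with a lamp stand: a finite set of lit lamps (positions in $\mathbb Z$) together with an integer position of the lamplighter. The identity $id$ has no lit lamps and lamplighter at $0$; right multiplication by $a$ toggles the lamp at the lamplighter's position; right multiplication by $t$ moves the lamplighter by $+1$. $d$ is the word metric on $L_2$ with respect to $S=\{t,at\}$. $H(g)$ is the lamplighter's position in $g$; $m(g)$ (resp. $M(g)$) is the minimum (resp. maximum) position of a lit lamp of $g$, with $m(g)=+\infty$, $M(g)=-\infty$ if no lamp is lit. $m(g_1,g_2)$ (resp. $M(g_1,g_2)$) is the minimum (resp. maximum) position of a lamp whose status differs in $g_1$ and $g_2$, with value $+\infty$ (resp. $-\infty$) if there is none. Horofunction boundary: $C(L_2)$ is the space of functions $L_2\to\mathbb R$ with the topology of uniform convergence on compact (i.e. finite) sets, so convergence is pointwise convergence; $i(z)(x)=d(z,x)-d(z,id)$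 embeds $L_2$ in $C(L_2)$; $\overline{L_2}$ is the closure of $i(L_2)$ and $\partial_h L_2=\overline{L_2}\setminus i(L_2)$. The following functions are points of $\partial_h L_2$: $\mathfrak s^l(g)=|l|-|l-H(g)|$ for $l\in\mathbb Z$; $\mathfrak r^{+,f}(g)=2(\min\{m(f),l,0\}-\min\{m(f,g),H(g),l\})+\mathfrak s^l(g)$ where $l=H(f)$ and $M(f)<l$; $\mathfrak r^{-,f}(g)=2(\max\{M(f,g)+1,H(g),l\}-\max\{M(f)+1,l,0\})+\mathfrak s^l(g)$ where $l=H(f)$ and $m(f)\ge l$. *)

theory Defs
  imports "HOL-Analysis.Analysis" "HOL-Algebra.Generated_Groups" "HOL-Library.FSet"
begin

section \<open>The lamplighter group\<close>

text \<open>
  Elements of \<open>L\<^sub>2 = (\<Oplus>\<^sub>\<int> \<int>/2) \<rtimes> \<int>\<close> are lamp stands: a finite set of lit lamps together with the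
  position of the lamplighter. The product is that of the semidirect product.
\<close>

datatype lampstand = Lampstand (lit: "int fset") (pos: int)

definition fsym_diff :: "'a fset \<Rightarrow> 'a fset \<Rightarrow> 'a fset" where
  "fsym_diff A B = (A |-| B) |\<union>| (B |-| A)"

definition L2 :: "lampstand monoid" where
  "L2 = \<lparr>carrier = UNIV,
         monoid.mult = (\<lambda>g h. Lampstand (fsym_diff (lit g) ((\<lambda>k. pos g + k) |`| lit h)) (pos g + pos h)),
         one = Lampstand {||} 0\<rparr>"

definition gen_a :: lampstand where "gen_a = Lampstand {|0|} 0"
definition gen_t :: lampstand where "gen_t = Lampstand {||} 1"

definition gens :: "lampstand set" where
  "gens = {gen_t, gen_a \<otimes>\<^bsub>L2\<^esub> gen_t}"

lemma fmember_fsym_diff: "x |\<in>| fsym_diff A B \<longleftrightarrow> (x |\<in>| A) \<noteq> (x |\<in>| B)"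
  by (auto simp: fsym_diff_def)

lemma mult_L2: "g \<otimes>\<^bsub>L2\<^esub> h =
    Lampstand (fsym_diff (lit g) ((\<lambda>k. pos g + k) |`| lit h)) (pos g + pos h)"
  by (simp add: L2_def)

lemma one_L2: "\<one>\<^bsub>L2\<^esub> = Lampstand {||} 0"
  by (simp add: L2_def)

lemma carrier_L2 [simp]: "carrier L2 = UNIV"
  by (simp add: L2_def)

lemma fmember_shift: "x |\<in>| (\<lambda>k. c + k) |`| A \<longleftrightarrow> x - c |\<in>| A" for x c :: int
  by (auto simp: image_iff) (metis add_diff_cancel_left' diff_add_cancel add.commute)

lemma lampstand_eqI:
  "(\<And>x. x |\<in>| lit g \<longleftrightarrow> x |\<in>| lit h) \<Longrightarrow> pos g = pos h \<Longrightarrow> g = h"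
  by (cases g; cases h) (auto intro: fset_eqI)

lemma group_L2: "group L2"
proof (rule groupI)
  fix g h k
  show "(g \<otimes>\<^bsub>L2\<^esub> h) \<otimes>\<^bsub>L2\<^esub> k = g \<otimes>\<^bsub>L2\<^esub> (h \<otimes>\<^bsub>L2\<^esub> k)"
    by (rule lampstand_eqI;
        simp only: mult_L2 lampstand.sel fmember_fsym_diff fmember_shift; simp add: algebra_simps; blast?)
next
  fix g
  show "\<one>\<^bsub>L2\<^esub> \<otimes>\<^bsub>L2\<^esub> g = g"
    by (rule lampstand_eqI;
        simp only: mult_L2 one_L2 lampstand.sel fmember_fsym_diff fmember_shift; simp)
  have "Lampstand ((\<lambda>k. - pos g + k) |`| lit g) (- pos g) \<otimes>\<^bsub>L2\<^esub> g = \<one>\<^bsub>L2\<^esub>"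
    by (rule lampstand_eqI;
        simp only: mult_L2 one_L2 lampstand.sel fmember_fsym_diff fmember_shift; simp)
  then show "\<exists>h\<in>carrier L2. h \<otimes>\<^bsub>L2\<^esub> g = \<one>\<^bsub>L2\<^esub>" by auto
qed auto

lemma mult_gen_a: "g \<otimes>\<^bsub>L2\<^esub> gen_a = Lampstand (fsym_diff (lit g) {|pos g|}) (pos g)"
  by (simp add: mult_L2 gen_a_def)

lemma mult_gen_t: "g \<otimes>\<^bsub>L2\<^esub> gen_t = Lampstand (lit g) (pos g + 1)"
  by (simp add: mult_L2 gen_t_def fsym_diff_def)

lemma generate_gens: "generate L2 gens = UNIV"
proof -
  interpret group L2 by (rule group_L2)
  let ?G = "generate L2 gens"
  have t: "gen_t \<in> ?G" and at: "gen_a \<otimes>\<^bsub>L2\<^esub> gen_t \<in> ?G"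
    by (auto simp: gens_def intro: generate.incl)
  have ti: "inv\<^bsub>L2\<^esub> gen_t \<in> ?G"
    by (auto simp: gens_def intro: generate.inv)
  have inv_t: "inv\<^bsub>L2\<^esub> gen_t = Lampstand {||} (-1)"
    by (rule inv_equality) (auto simp: mult_L2 one_L2 gen_t_def fsym_diff_def)
  have "(gen_a \<otimes>\<^bsub>L2\<^esub> gen_t) \<otimes>\<^bsub>L2\<^esub> inv\<^bsub>L2\<^esub> gen_t \<in> ?G"
    by (rule generate.eng[OF at ti])
  then have a: "gen_a \<in> ?G"
    by (simp add: m_assoc)
  have pw: "Lampstand {||} k \<in> ?G" for k
  proof (induction k rule: int_induct[where k = 0])
    case base
    then show ?case using generate.one[of L2 gens] by (simp add: one_L2)
  next
    case (step1 i)
    then show ?case using generate.eng[OF step1(2) t] by (simp add: mult_gen_t)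
  next
    case (step2 i)
    then show ?case using generate.eng[OF step2(2) ti]
      by (simp add: mult_L2 inv_t fsym_diff_def)
  qed
  have "Lampstand A k \<in> ?G" for A k
  proof (induction A)
    case empty
    then show ?case by (rule pw)
  next
    case (insert x A)
    have "((Lampstand {||} x \<otimes>\<^bsub>L2\<^esub> gen_a) \<otimes>\<^bsub>L2\<^esub> Lampstand {||} (- x)) \<otimes>\<^bsub>L2\<^esub> Lampstand A k \<in> ?G"
      by (intro generate.eng pw a insert)
    also have "((Lampstand {||} x \<otimes>\<^bsub>L2\<^esub> gen_a) \<otimes>\<^bsub>L2\<^esub> Lampstand {||} (- x)) \<otimes>\<^bsub>L2\<^esub> Lampstand A k
        = Lampstand (finsert x A) k"
      using insert by (intro lampstand_eqI;
          simp only: mult_L2 gen_a_def lampstand.sel fmember_fsym_diff fmember_shift; auto)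
    finally show ?case .
  qed
  then show ?thesis by (metis UNIV_eq_I lampstand.exhaust)
qed


section \<open>Word metrics and the horofunction boundary\<close>

definition word_length :: "('a, 'b) monoid_scheme \<Rightarrow> 'a set \<Rightarrow> 'a \<Rightarrow> nat" where
  "word_length G S g =
     (LEAST n. \<exists>w. length w = n \<and> set w \<subseteq> S \<union> m_inv G ` S \<and> foldr (monoid.mult G) w \<one>\<^bsub>G\<^esub> = g)"

definition word_dist :: "('a, 'b) monoid_scheme \<Rightarrow> 'a set \<Rightarrow> 'a \<Rightarrow> 'a \<Rightarrow> real" where
  "word_dist G S g h = real (word_length G S (inv\<^bsub>G\<^esub> g \<otimes>\<^bsub>G\<^esub> h))"

text \<open>
  The group is discrete, so its compact subsets are the finite ones, every real function on it is
  continuous, and \<open>C(L\<^sub>2)\<close> is the whole function type with its product topology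
  (pointwise convergence), which is the topology \<^theory>\<open>HOL-Analysis.Function_Topology\<close> puts on it.
\<close>

definition horo_embedding :: "('a \<Rightarrow> 'a \<Rightarrow> real) \<Rightarrow> 'a \<Rightarrow> 'a \<Rightarrow> ('a \<Rightarrow> real)" where
  "horo_embedding d b z = (\<lambda>x. d z x - d z b)"

definition horo_boundary :: "('a \<Rightarrow> 'a \<Rightarrow> real) \<Rightarrow> 'a \<Rightarrow> ('a \<Rightarrow> real) set" where
  "horo_boundary d b = closure (range (horo_embedding d b)) - range (horo_embedding d b)"

definition boundary_L2 :: "(lampstand \<Rightarrow> real) set" where
  "boundary_L2 = horo_boundary (word_dist L2 gens) \<one>\<^bsub>L2\<^esub>"


section \<open>The horofunctions\<close>

definition min_pos :: "int fset \<Rightarrow> ereal" where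
  "min_pos A = (if A = {||} then \<infinity> else ereal (real_of_int (fMin A)))"

definition max_pos :: "int fset \<Rightarrow> ereal" where
  "max_pos A = (if A = {||} then - \<infinity> else ereal (real_of_int (fMax A)))"

definition min_lit :: "lampstand \<Rightarrow> ereal" where
  "min_lit g = min_pos (lit g)"

definition max_lit :: "lampstand \<Rightarrow> ereal" where
  "max_lit g = max_pos (lit g)"

definition min_diff :: "lampstand \<Rightarrow> lampstand \<Rightarrow> ereal" where
  "min_diff g h = min_pos (fsym_diff (lit g) (lit h))"

definition max_diff :: "lampstand \<Rightarrow> lampstand \<Rightarrow> ereal" where
  "max_diff g h = max_pos (fsym_diff (lit g) (lit h))"

definition horo_s :: "int \<Rightarrow> lampstand \<Rightarrow> real" where
  "horo_s l g = real_of_int (\<bar>l\<bar> - \<bar>l - pos g\<bar>)"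

text \<open>
  The minima and maxima below are finite because they include integers, so \<^const>\<open>real_of_ereal\<close>
  loses nothing. The function \<open>horo_r_plus f\<close> is meant for \<open>max_lit f < pos f\<close> and
  \<open>horo_r_minus f\<close> for \<open>pos f \<le> min_lit f\<close>.
\<close>

definition horo_r_plus :: "lampstand \<Rightarrow> lampstand \<Rightarrow> real" where
  "horo_r_plus f g = (let l = pos f in
     2 * (real_of_ereal (min (min_lit f) (min (ereal (real_of_int l)) 0))
          - real_of_ereal (min (min_diff f g) (min (ereal (real_of_int (pos g))) (ereal (real_of_int l)))))
     + horo_s l g)"

definition horo_r_minus :: "lampstand \<Rightarrow> lampstand \<Rightarrow> real" where
  "horo_r_minus f g = (let l = pos f in
     2 * (real_of_ereal (max (max_diff f g + 1) (max (ereal (real_of_int (pos g))) (ereal (real_of_int l))))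
          - real_of_ereal (max (max_lit f + 1) (max (ereal (real_of_int l)) 0)))
     + horo_s l g)"

end

theory Submission
  imports Defs
begin

text \<open>
  A word for \<open>f\<inverse>g\<close> is a walk of the lamplighter from \<open>pos f\<close> to \<open>pos g\<close> along the edges of \<open>\<int>\<close>,
  crossing every edge \<open>[k, k + 1]\<close> whose lamp \<open>k\<close> differs. If \<open>[lo, hi]\<close> is the smallest interval
  that such a walk has to sweep, then \<open>d(f, g) = 2 (hi - lo) - \<bar>pos f - pos g\<bar>\<close>. Hence lighting a
  lamp of \<open>f\<close> far to the right makes \<open>hi\<close> independent of \<open>g\<close> and leaves only the term \<open>lo\<close> in
  \<open>d(f, g) - d(f, 1)\<close>: the limits are the functions \<open>horo_r_plus f\<close>. A far lamp on the left does
  the same to \<open>lo\<close>. Such limits are not of the form \<open>d(f, _) - d(f, 1)\<close>, as they are unbounded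
  below along unlit stands. For fixed \<open>g\<close>, \<open>horo_r_plus (f n) g\<close> is eventually equal to
  \<open>horo_s l g\<close> once a lamp of \<open>f n\<close> lies far enough to the left.
\<close>

section \<open>The word metric\<close>

text \<open>\<open>[m, M]\<close> contains the start 0, the end \<open>pos g\<close> and all edges
  \<open>[k, k + 1]\<close> of lit lamps \<open>k\<close>; hence the strict bound on the right
  only.\<close>

definition fits :: "int \<Rightarrow> int \<Rightarrow> lampstand \<Rightarrow> bool" where
  "fits m M g \<longleftrightarrow> m \<le> 0 \<and> 0 \<le> M \<and> m \<le> pos g \<and> pos g \<le> M \<and> (\<forall>k. k |\<in>| lit g \<longrightarrow> m \<le> k \<and> k < M)"

lemma fitsI:
  assumes "m \<le> 0" "0 \<le> M" "m \<le> pos g" "pos g \<le> M"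
    and "\<And>k. k |\<in>| lit g \<Longrightarrow> m \<le> k" "\<And>k. k |\<in>| lit g \<Longrightarrow> k < M"
  shows "fits m M g"
  using assms by (simp add: fits_def)

lemma fitsD:
  assumes "fits m M g"
  shows "m \<le> 0" "0 \<le> M" "m \<le> pos g" "pos g \<le> M"
    and "\<And>k. k |\<in>| lit g \<Longrightarrow> m \<le> k" "\<And>k. k |\<in>| lit g \<Longrightarrow> k < M"
  using assms by (simp_all add: fits_def)

lemma inv_L2: "inv\<^bsub>L2\<^esub> g = Lampstand ((\<lambda>k. - pos g + k) |`| lit g) (- pos g)"
proof -
  interpret group L2 by (rule group_L2)
  have "Lampstand ((\<lambda>k. - pos g + k) |`| lit g) (- pos g) \<otimes>\<^bsub>L2\<^esub> g = \<one>\<^bsub>L2\<^esub>"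
    by (rule lampstand_eqI;
        simp only: mult_L2 one_L2 lampstand.sel fmember_fsym_diff fmember_shift; simp)
  then show ?thesis by (intro inv_equality) auto
qed

text \<open>A lamp is toggled only while its edge is crossed: \<open>at\<close> toggles before
  moving right, its inverse after moving left, hence at \<open>-1\<close>.\<close>

lemma steps_eq:
  "gens \<union> m_inv L2 ` gens =
     {Lampstand {||} 1, Lampstand {|0|} 1, Lampstand {||} (-1), Lampstand {|-1|} (-1)}"
proof -
  have "gen_a \<otimes>\<^bsub>L2\<^esub> gen_t = Lampstand {|0|} 1"
    by (simp add: mult_gen_t gen_a_def)
  then show ?thesis
    by (auto simp: gens_def inv_L2 gen_t_def)
qed

text \<open>Lower bound on lengths of words. Prepending a letter translates the swept interval by
  one and enlarges it, if necessary, to contain the new start 0.\<close>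

lemma word_fits:
  assumes "set w \<subseteq> gens \<union> m_inv L2 ` gens"
  shows "\<exists>m M. fits m M (foldr (monoid.mult L2) w \<one>\<^bsub>L2\<^esub>) \<and>
           2 * (M - m) - \<bar>pos (foldr (monoid.mult L2) w \<one>\<^bsub>L2\<^esub>)\<bar> \<le> int (length w)"
  using assms
proof (induction w)
  case Nil
  have "fits 0 0 \<one>\<^bsub>L2\<^esub>" "pos \<one>\<^bsub>L2\<^esub> = 0"
    by (auto simp: fits_def one_L2)
  then show ?case by force
next
  case (Cons s w)
  define g where "g = foldr (monoid.mult L2) w \<one>\<^bsub>L2\<^esub>"
  obtain m M where mM: "fits m M g" "2 * (M - m) - \<bar>pos g\<bar> \<le> int (length w)"
    using Cons by (auto simp: g_def)
  have "s \<in> {Lampstand {||} 1, Lampstand {|0|} 1, Lampstand {||} (-1), Lampstand {|-1|} (-1)}"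
    using Cons.prems unfolding steps_eq by simp
  then consider "pos s = 1" "\<And>x. x |\<in>| lit s \<Longrightarrow> x = 0" | "pos s = -1" "\<And>x. x |\<in>| lit s \<Longrightarrow> x = -1"
    by force
  then have "\<exists>m M. fits m M (s \<otimes>\<^bsub>L2\<^esub> g) \<and> 2 * (M - m) - \<bar>pos (s \<otimes>\<^bsub>L2\<^esub> g)\<bar> \<le> int (length w) + 1"
  proof cases
    case 1
    have lit: "x = 0 \<or> x - 1 |\<in>| lit g" if "x |\<in>| lit (s \<otimes>\<^bsub>L2\<^esub> g)" for x
      using that 1 unfolding mult_L2 lampstand.sel fmember_fsym_diff fmember_shift by auto
    \<comment> \<open>The translate \<open>[m + 1, M + 1]\<close> misses 0 only if
      \<open>m = 0\<close>. Then \<open>pos g\<close> is nonnegative, and its growth pays for half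
      of the cost 2 of the longer interval.\<close>
    have "fits (min 0 (m + 1)) (M + 1) (s \<otimes>\<^bsub>L2\<^esub> g)"
      by (rule fitsI) (use 1(1) fitsD[OF mM(1)] in \<open>fastforce simp: mult_L2 dest!: lit\<close>)+
    moreover have "2 * ((M + 1) - min 0 (m + 1)) - \<bar>pos (s \<otimes>\<^bsub>L2\<^esub> g)\<bar> \<le> int (length w) + 1"
      unfolding mult_L2 lampstand.sel 1(1) using mM(2) fitsD(1-4)[OF mM(1)] by (cases "m = 0") auto
    ultimately show ?thesis by blast
  next
    case 2
    have lit: "x = -1 \<or> x + 1 |\<in>| lit g" if "x |\<in>| lit (s \<otimes>\<^bsub>L2\<^esub> g)" for x
      using that 2 unfolding mult_L2 lampstand.sel fmember_fsym_diff fmember_shift by auto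
    have "fits (m - 1) (max 0 (M - 1)) (s \<otimes>\<^bsub>L2\<^esub> g)"
      by (rule fitsI) (use 2(1) fitsD[OF mM(1)] in \<open>fastforce simp: mult_L2 dest!: lit\<close>)+
    moreover have "2 * (max 0 (M - 1) - (m - 1)) - \<bar>pos (s \<otimes>\<^bsub>L2\<^esub> g)\<bar> \<le> int (length w) + 1"
      unfolding mult_L2 lampstand.sel 2(1) using mM(2) fitsD(1-4)[OF mM(1)] by (cases "M = 0") auto
    ultimately show ?thesis by blast
  qed
  then show ?case by (simp add: g_def add.commute)
qed

text \<open>A shortest walk first visits the end of the interval that lies away from its target.\<close>

lemma fits_first_step:
  assumes "fits m M g" "m \<noteq> 0 \<or> M \<noteq> 0"
  shows "\<exists>s\<in>gens \<union> m_inv L2 ` gens. \<exists>h m' M'. g = s \<otimes>\<^bsub>L2\<^esub> h \<and> fits m' M' h \<and>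
           2 * (M' - m') - \<bar>pos h\<bar> = 2 * (M - m) - \<bar>pos g\<bar> - 1"
\<comment> \<open>The first case steps right: either the target is not on the left and nothing
  remains to be swept there, or the target is on the left and the right end comes first.\<close>
proof (cases "if 0 \<le> pos g then m = 0 else M > 0")
  case True
  then have M: "M > 0" using assms by (auto simp: fits_def split: if_splits)
  \<comment> \<open>The lamp of the crossed edge is set to its final state at once, so
    \<open>h\<close>, which is the inverse of \<open>s\<close> times \<open>g\<close>, has lamp
    \<open>-1\<close> unlit.\<close>
  define s where "s = Lampstand (if 0 |\<in>| lit g then {|0|} else {||}) 1"
  define h where "h = Lampstand (if 0 |\<in>| lit g then {|-1|} else {||}) (-1) \<otimes>\<^bsub>L2\<^esub> g"
  have "s \<in> gens \<union> m_inv L2 ` gens" by (simp add: steps_eq s_def)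
  moreover have "g = s \<otimes>\<^bsub>L2\<^esub> h"
    by (rule lampstand_eqI;
        simp only: s_def h_def mult_L2 lampstand.sel fmember_fsym_diff fmember_shift; auto)
  moreover have h: "pos h = pos g - 1" "\<And>x. x |\<in>| lit h \<longleftrightarrow> x \<noteq> -1 \<and> x + 1 |\<in>| lit g"
     by (simp only: h_def mult_L2 lampstand.sel fmember_fsym_diff fmember_shift; auto)+
  \<comment> \<open>If \<open>pos g \<ge> 1\<close>, then \<open>m = 0\<close> and the walk need not
    return: the crossed edge leaves the interval. Otherwise the edge is crossed again, the interval
    is only translated, and the distance to the target grows by one. Either way the length drops by
    one.\<close>
  have "fits (if pos g \<ge> 1 then m else m - 1) (M - 1) h"
    by (rule fitsI) (use fitsD[OF assms(1)] M True h(1) in \<open>fastforce simp: h(2) split: if_splits\<close>)+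
  moreover have "2 * ((M - 1) - (if pos g \<ge> 1 then m else m - 1)) - \<bar>pos h\<bar> = 2 * (M - m) - \<bar>pos g\<bar> - 1"
    using h True by auto
  ultimately show ?thesis by blast
next
  case False
  then have m: "m < 0" using assms by (auto simp: fits_def split: if_splits)
  \<comment> \<open>A step to the left crosses the edge \<open>[-1, 0]\<close>, which carries lamp
    \<open>-1\<close>.\<close>
  define s where "s = Lampstand (if -1 |\<in>| lit g then {|-1|} else {||}) (-1)"
  define h where "h = Lampstand (if -1 |\<in>| lit g then {|0|} else {||}) 1 \<otimes>\<^bsub>L2\<^esub> g"
  have "s \<in> gens \<union> m_inv L2 ` gens" by (simp add: steps_eq s_def)
  moreover have "g = s \<otimes>\<^bsub>L2\<^esub> h"
    by (rule lampstand_eqI;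
        simp only: s_def h_def mult_L2 lampstand.sel fmember_fsym_diff fmember_shift; auto)
  moreover have h: "pos h = pos g + 1" "\<And>x. x |\<in>| lit h \<longleftrightarrow> x \<noteq> 0 \<and> x - 1 |\<in>| lit g"
     by (simp only: h_def mult_L2 lampstand.sel fmember_fsym_diff fmember_shift; auto)+
  have "fits (m + 1) (if pos g < 0 then M else M + 1) h"
    by (rule fitsI) (use fitsD[OF assms(1)] m False h(1) in \<open>fastforce simp: h(2) split: if_splits\<close>)+
  moreover have "2 * ((if pos g < 0 then M else M + 1) - (m + 1)) - \<bar>pos h\<bar> = 2 * (M - m) - \<bar>pos g\<bar> - 1"
    using h False by auto
  ultimately show ?thesis by blast
qed

text \<open>Upper bound: first steps are split off until the interval is the single point 0; each
  lowers the nonnegative quantity \<open>2 * (M - m) - \<bar>pos g\<bar>\<close> by one.\<close>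

lemma fits_word:
  assumes "fits m M g"
  shows "\<exists>w. set w \<subseteq> gens \<union> m_inv L2 ` gens \<and> foldr (monoid.mult L2) w \<one>\<^bsub>L2\<^esub> = g \<and>
           int (length w) = 2 * (M - m) - \<bar>pos g\<bar>"
  using assms
proof (induction "nat (2 * (M - m) - \<bar>pos g\<bar>)" arbitrary: m M g rule: less_induct)
  case less
  show ?case
  proof (cases "m = 0 \<and> M = 0")
    case True
    then have "g = \<one>\<^bsub>L2\<^esub>" "pos g = 0"
      using less.prems by (auto simp: fits_def one_L2 intro!: lampstand_eqI)
    then show ?thesis using True by (intro exI[of _ "[]"]) simp
  next
    case False
    then obtain s h m' M' where s: "s \<in> gens \<union> m_inv L2 ` gens" "g = s \<otimes>\<^bsub>L2\<^esub> h" "fits m' M' h"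
      "2 * (M' - m') - \<bar>pos h\<bar> = 2 * (M - m) - \<bar>pos g\<bar> - 1"
      using fits_first_step[OF less.prems] by blast
    moreover have "0 \<le> 2 * (M' - m') - \<bar>pos h\<bar>"
      using s(3) by (auto simp: fits_def)
    ultimately obtain w where "set w \<subseteq> gens \<union> m_inv L2 ` gens" "foldr (monoid.mult L2) w \<one>\<^bsub>L2\<^esub> = h"
      "int (length w) = 2 * (M' - m') - \<bar>pos h\<bar>"
      using less.hyps[of M' m' h] by auto
    then show ?thesis using s by (intro exI[of _ "s # w"]) auto
  qed
qed

lemma word_length_L2:
  assumes "fits m M g" "\<And>m' M'. fits m' M' g \<Longrightarrow> m' \<le> m \<and> M \<le> M'"
  shows "int (word_length L2 gens g) = 2 * (M - m) - \<bar>pos g\<bar>"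
proof -
  have "word_length L2 gens g = nat (2 * (M - m) - \<bar>pos g\<bar>)"
    unfolding word_length_def
  proof (rule Least_equality)
    show "\<exists>w. length w = nat (2 * (M - m) - \<bar>pos g\<bar>) \<and> set w \<subseteq> gens \<union> m_inv L2 ` gens \<and>
            foldr (monoid.mult L2) w \<one>\<^bsub>L2\<^esub> = g"
      using fits_word[OF assms(1)] by (metis nat_int)
  next
    fix n
    assume "\<exists>w. length w = n \<and> set w \<subseteq> gens \<union> m_inv L2 ` gens \<and> foldr (monoid.mult L2) w \<one>\<^bsub>L2\<^esub> = g"
    then obtain m' M' where "fits m' M' g" "2 * (M' - m') - \<bar>pos g\<bar> \<le> int n"
      using word_fits by blast
    then show "nat (2 * (M - m) - \<bar>pos g\<bar>) \<le> n"
      using assms(2)[of m' M'] by auto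
  qed
  moreover have "0 \<le> 2 * (M - m) - \<bar>pos g\<bar>"
    using assms(1) by (auto simp: fits_def)
  ultimately show ?thesis by simp
qed

section \<open>Spans of two lamp stands and the distance formula\<close>

lemma le_fMin_iff:
  fixes c :: "'a :: linorder"
  shows "A \<noteq> {||} \<Longrightarrow> c \<le> fMin A \<longleftrightarrow> (\<forall>x\<in>fset A. c \<le> x)"
  by (meson fMin_in fMin_le order_trans)

lemma fMax_le_iff:
  fixes c :: "'a :: linorder"
  shows "A \<noteq> {||} \<Longrightarrow> fMax A \<le> c \<longleftrightarrow> (\<forall>x\<in>fset A. x \<le> c)"
  by (meson fMax_in fMax_ge order_trans)

definition span_lo :: "lampstand \<Rightarrow> lampstand \<Rightarrow> int" where
  "span_lo f g = fMin (finsert (pos f) (finsert (pos g) (fsym_diff (lit f) (lit g))))"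

text \<open>The shift by one is the right end of the edge \<open>[k, k + 1]\<close> of a differing
  lamp \<open>k\<close>; its left end \<open>k\<close> enters \<open>span_lo\<close>
  unshifted.\<close>

definition span_hi :: "lampstand \<Rightarrow> lampstand \<Rightarrow> int" where
  "span_hi f g = fMax (finsert (pos f) (finsert (pos g) ((\<lambda>k. k + 1) |`| fsym_diff (lit f) (lit g))))"

lemma le_span_lo_iff:
  "c \<le> span_lo f g \<longleftrightarrow> c \<le> pos f \<and> c \<le> pos g \<and> (\<forall>k. (k |\<in>| lit f) \<noteq> (k |\<in>| lit g) \<longrightarrow> c \<le> k)"
  unfolding span_lo_def by (subst le_fMin_iff) (auto simp: fmember_fsym_diff simp del: fMin_finsert)

lemma span_hi_le_iff:
  "span_hi f g \<le> c \<longleftrightarrow> pos f \<le> c \<and> pos g \<le> c \<and> (\<forall>k. (k |\<in>| lit f) \<noteq> (k |\<in>| lit g) \<longrightarrow> k < c)"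
proof -
  have "span_hi f g \<le> c \<longleftrightarrow> pos f \<le> c \<and> pos g \<le> c \<and> (\<forall>k\<in>fset (fsym_diff (lit f) (lit g)). k + 1 \<le> c)"
    unfolding span_hi_def by (subst fMax_le_iff) (simp_all del: fMax_finsert)
  then show ?thesis
    by (simp add: Ball_def fmember_fsym_diff add1_zle_eq)
qed

lemma word_dist_L2:
  "word_dist L2 gens f g = real_of_int (2 * (span_hi f g - span_lo f g) - \<bar>pos f - pos g\<bar>)"
proof -
  define h where "h = inv\<^bsub>L2\<^esub> f \<otimes>\<^bsub>L2\<^esub> g"
  have pos: "pos h = pos g - pos f"
    by (simp add: h_def inv_L2 mult_L2)
  have lit: "x |\<in>| lit h \<longleftrightarrow> (x + pos f |\<in>| lit f) \<noteq> (x + pos f |\<in>| lit g)" for x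
    by (simp only: h_def inv_L2 mult_L2 lampstand.sel fmember_fsym_diff fmember_shift; simp)
  have shift: "(\<forall>k. P (k + pos f)) \<longleftrightarrow> (\<forall>k. P k)" for P
    by (metis diff_add_cancel)
  have lo: "m + pos f \<le> span_lo f g \<longleftrightarrow> m \<le> 0 \<and> m \<le> pos h \<and> (\<forall>k. k |\<in>| lit h \<longrightarrow> m \<le> k)" for m
    using shift[of "\<lambda>k. (k |\<in>| lit f) \<noteq> (k |\<in>| lit g) \<longrightarrow> m + pos f \<le> k"]
    by (simp add: le_span_lo_iff lit pos le_diff_eq)
  have hi: "span_hi f g \<le> M + pos f \<longleftrightarrow> 0 \<le> M \<and> pos h \<le> M \<and> (\<forall>k. k |\<in>| lit h \<longrightarrow> k < M)" for M
    using shift[of "\<lambda>k. (k |\<in>| lit f) \<noteq> (k |\<in>| lit g) \<longrightarrow> k < M + pos f"]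
    by (simp add: span_hi_le_iff lit pos diff_le_eq)
  \<comment> \<open>In coordinates moved by \<open>pos f\<close>, the intervals that fit
    \<open>h\<close> are exactly those containing the span of \<open>f\<close> and \<open>g\<close>,
    so the span itself is the least one.\<close>
  have fits: "fits m M h \<longleftrightarrow> m + pos f \<le> span_lo f g \<and> span_hi f g \<le> M + pos f" for m M
    unfolding fits_def lo hi by blast
  have "int (word_length L2 gens h) = 2 * ((span_hi f g - pos f) - (span_lo f g - pos f)) - \<bar>pos h\<bar>"
    by (rule word_length_L2) (auto simp: fits)
  then have "int (word_length L2 gens h) = 2 * (span_hi f g - span_lo f g) - \<bar>pos f - pos g\<bar>"
    unfolding pos by (simp add: abs_minus_commute[of "pos f" "pos g"])
  then have "real_of_int (int (word_length L2 gens h)) =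
      real_of_int (2 * (span_hi f g - span_lo f g) - \<bar>pos f - pos g\<bar>)"
    by (rule arg_cong)
  then show ?thesis
    by (simp only: word_dist_def h_def of_int_of_nat_eq)
qed

section \<open>The horofunctions in terms of spans\<close>

text \<open>The absolute values in the two distances combine to \<open>horo_s\<close>. What remains
  separates into a right-end and a left-end term, which can be made to vanish independently.\<close>

lemma horo_embedding_L2:
  "horo_embedding (word_dist L2 gens) \<one>\<^bsub>L2\<^esub> f g =
     real_of_int (2 * (span_hi f g - span_hi f \<one>\<^bsub>L2\<^esub>) + 2 * (span_lo f \<one>\<^bsub>L2\<^esub> - span_lo f g))
       + horo_s (pos f) g"
  by (simp add: horo_embedding_def word_dist_L2 horo_s_def one_L2)

lemma real_of_ereal_min_pos:
  "real_of_ereal (min (min_pos A) (min (ereal (real_of_int x)) (ereal (real_of_int y)))) =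
     real_of_int (fMin (finsert x (finsert y A)))"
  by (auto simp: min_pos_def min_def)

lemma real_of_ereal_max_pos:
  "real_of_ereal (max (max_pos A + 1) (max (ereal (real_of_int x)) (ereal (real_of_int y)))) =
     real_of_int (fMax (finsert x (finsert y ((\<lambda>k. k + 1) |`| A))))"
proof (cases "A = {||}")
  case False
  have "fMax ((\<lambda>k. k + 1) |`| A) = fMax A + 1"
    using mono_fMax_commute[of "\<lambda>k::int. k + 1" A] False by (auto simp: mono_def)
  then show ?thesis
    using False by (auto simp: max_pos_def max_def one_ereal_def)
qed (auto simp: max_pos_def max_def)

text \<open>The two minima in the definition are left ends of spans, so \<open>horo_r_plus f\<close>
  is the embedding of \<open>f\<close> without its right-end term.\<close>

lemma horo_r_plus_span:
  "horo_r_plus f g = real_of_int (2 * (span_lo f \<one>\<^bsub>L2\<^esub> - span_lo f g)) + horo_s (pos f) g"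
proof -
  have "real_of_ereal (min (min_lit f) (min (ereal (real_of_int (pos f))) 0)) = span_lo f \<one>\<^bsub>L2\<^esub>"
    using real_of_ereal_min_pos[of "lit f" "pos f" 0]
    by (simp add: min_lit_def span_lo_def one_L2 fsym_diff_def zero_ereal_def)
  moreover have "real_of_ereal (min (min_diff f g) (min (ereal (real_of_int (pos g))) (ereal (real_of_int (pos f))))) = span_lo f g"
    unfolding min_diff_def real_of_ereal_min_pos span_lo_def by (simp add: finsert_commute)
  ultimately show ?thesis by (simp only: horo_r_plus_def Let_def of_int_mult of_int_diff of_int_numeral)
qed

lemma horo_r_minus_span:
  "horo_r_minus f g = real_of_int (2 * (span_hi f g - span_hi f \<one>\<^bsub>L2\<^esub>)) + horo_s (pos f) g"
proof -
  have "real_of_ereal (max (max_lit f + 1) (max (ereal (real_of_int (pos f))) 0)) = span_hi f \<one>\<^bsub>L2\<^esub>"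
    using real_of_ereal_max_pos[of "lit f" "pos f" 0]
    by (simp add: max_lit_def span_hi_def one_L2 fsym_diff_def zero_ereal_def)
  moreover have "real_of_ereal (max (max_diff f g + 1) (max (ereal (real_of_int (pos g))) (ereal (real_of_int (pos f))))) = span_hi f g"
    unfolding max_diff_def real_of_ereal_max_pos span_hi_def by (simp add: finsert_commute)
  ultimately show ?thesis by (simp only: horo_r_minus_def Let_def of_int_mult of_int_diff of_int_numeral)
qed

section \<open>The effect of an outermost lamp on the spans\<close>

lemma span_lo_far_lamp:
  assumes "k |\<in>| lit f" "\<And>j. j |\<in>| lit f \<Longrightarrow> k \<le> j" "\<And>j. j |\<in>| lit g \<Longrightarrow> k < j" "k \<le> pos f" "k \<le> pos g"
  shows "span_lo f g = k"
proof (rule antisym)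
  show "span_lo f g \<le> k"
    using le_span_lo_iff[of "span_lo f g" f g] assms by force
  show "k \<le> span_lo f g"
    unfolding le_span_lo_iff using assms by (auto dest: less_imp_le)
qed

lemma span_hi_far_lamp:
  assumes "k |\<in>| lit f" "\<And>j. j |\<in>| lit f \<Longrightarrow> j \<le> k" "\<And>j. j |\<in>| lit g \<Longrightarrow> j < k" "pos f \<le> k" "pos g \<le> k"
  shows "span_hi f g = k + 1"
proof (rule antisym)
  show "k + 1 \<le> span_hi f g"
    using span_hi_le_iff[of f g "span_hi f g"] assms by force
  show "span_hi f g \<le> k + 1"
    unfolding span_hi_le_iff using assms by force
qed

text \<open>The new differing lamp \<open>k\<close> cannot lower a minimum that already includes
  \<open>pos g\<close>.\<close>

lemma span_lo_finsert:
  assumes "k |\<notin>| lit f" "k |\<notin>| lit g" "pos g \<le> k"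
  shows "span_lo (Lampstand (finsert k (lit f)) (pos f)) g = span_lo f g"
proof -
  have "c \<le> span_lo (Lampstand (finsert k (lit f)) (pos f)) g \<longleftrightarrow> c \<le> span_lo f g" for c
    unfolding le_span_lo_iff using assms by (auto intro: order_trans)
  then show ?thesis by (meson antisym order_refl)
qed

lemma span_hi_finsert:
  assumes "k |\<notin>| lit f" "k |\<notin>| lit g" "k < pos g"
  shows "span_hi (Lampstand (finsert k (lit f)) (pos f)) g = span_hi f g"
proof -
  have "span_hi (Lampstand (finsert k (lit f)) (pos f)) g \<le> c \<longleftrightarrow> span_hi f g \<le> c" for c
    unfolding span_hi_le_iff using assms by (auto intro: less_le_trans)
  then show ?thesis by (meson antisym order_refl)
qed

section \<open>Limits of the embedding\<close>

lemma eventually_abs_less: "eventually (\<lambda>n. \<bar>c\<bar> < int n) sequentially"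
  by (rule eventually_sequentiallyI[of "nat (\<bar>c\<bar> + 1)"]) simp

lemma eventually_fset_abs_less: "eventually (\<lambda>n. \<forall>k\<in>fset A. \<bar>k\<bar> < int n) sequentially"
  by (intro eventually_ball_finite finite_fset ballI eventually_abs_less)

text \<open>Both signs of \<open>p\<close> are provided, as \<open>horo_r_plus\<close> is compared
  with \<open>horo_s\<close> for \<open>p \<ge> 0\<close> and \<open>horo_r_minus\<close> for
  \<open>p \<le> 0\<close>.\<close>

lemma horo_s_unbounded:
  "\<exists>p \<ge> 0. horo_s l (Lampstand {||} p) < - real N" "\<exists>p \<le> 0. horo_s l (Lampstand {||} p) < - real N"
proof -
  \<comment> \<open>At \<open>P\<close> and at \<open>- P\<close> the value of
    \<open>horo_s l\<close> is at most \<open>2 * \<bar>l\<bar> - P\<close>, which is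
    \<open>- N - 1\<close>.\<close>
  define P where "P = 2 * \<bar>l\<bar> + int N + 1"
  have "\<bar>l\<bar> - \<bar>l - P\<bar> < - int N" "\<bar>l\<bar> - \<bar>l - - P\<bar> < - int N"
    unfolding P_def by linarith+
  then have "real_of_int (\<bar>l\<bar> - \<bar>l - P\<bar>) < real_of_int (- int N)"
    "real_of_int (\<bar>l\<bar> - \<bar>l - - P\<bar>) < real_of_int (- int N)"
    by (simp_all only: of_int_less_iff)
  then have "horo_s l (Lampstand {||} P) < - real N" "horo_s l (Lampstand {||} (- P)) < - real N"
    by (simp_all add: horo_s_def)
  moreover have "0 \<le> P" "- P \<le> 0" by (simp_all add: P_def)
  ultimately show "\<exists>p \<ge> 0. horo_s l (Lampstand {||} p) < - real N"
    "\<exists>p \<le> 0. horo_s l (Lampstand {||} p) < - real N"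
    by blast+
qed

lemma eventually_span_far_both:
  "eventually (\<lambda>n. span_hi (Lampstand {|- int n, int n|} l) g = int n + 1 \<and>
     span_lo (Lampstand {|- int n, int n|} l) g = - int n) sequentially"
  using eventually_fset_abs_less[of "lit g"] eventually_abs_less[of l] eventually_abs_less[of "pos g"]
proof eventually_elim
  case (elim n)
  have g: "- int n < j" "j < int n" if "j |\<in>| lit g" for j
    using bspec[OF elim(1) that] by simp_all
  have "span_hi (Lampstand {|- int n, int n|} l) g = int n + 1"
    by (rule span_hi_far_lamp) (use g elim(2,3) in \<open>simp; fail | force\<close>)+
  moreover have "span_lo (Lampstand {|- int n, int n|} l) g = - int n"
    by (rule span_lo_far_lamp) (use g elim(2,3) in \<open>simp; fail | force\<close>)+
  ultimately show ?case ..
qed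

text \<open>Far lamps on both sides fix both ends of the span for \<open>g\<close> and for the
  identity alike, so both span terms cancel.\<close>

lemma eventually_embedding_horo_s:
  "eventually (\<lambda>n. horo_embedding (word_dist L2 gens) \<one>\<^bsub>L2\<^esub>
     (Lampstand {|- int n, int n|} l) g = horo_s l g) sequentially"
  using eventually_span_far_both[of l g] eventually_span_far_both[of l "\<one>\<^bsub>L2\<^esub>"]
  by eventually_elim (simp add: horo_embedding_L2)

lemma eventually_span_far_right:
  "eventually (\<lambda>n. span_hi (Lampstand (finsert (int n) (lit f)) (pos f)) g = int n + 1 \<and>
     span_lo (Lampstand (finsert (int n) (lit f)) (pos f)) g = span_lo f g) sequentially"
  using eventually_fset_abs_less[of "lit f"] eventually_fset_abs_less[of "lit g"]
    eventually_abs_less[of "pos f"] eventually_abs_less[of "pos g"]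
proof eventually_elim
  case (elim n)
  have f: "- int n < j" "j < int n" if "j |\<in>| lit f" for j
    using bspec[OF elim(1) that] by simp_all
  have g: "- int n < j" "j < int n" if "j |\<in>| lit g" for j
    using bspec[OF elim(2) that] by simp_all
  have "span_hi (Lampstand (finsert (int n) (lit f)) (pos f)) g = int n + 1"
    by (rule span_hi_far_lamp) (use f g elim(3,4) in \<open>simp; fail | force\<close>)+
  moreover have "span_lo (Lampstand (finsert (int n) (lit f)) (pos f)) g = span_lo f g"
    by (rule span_lo_finsert) (use f g elim(3,4) in force)+
  ultimately show ?case ..
qed

lemma eventually_span_far_left:
  "eventually (\<lambda>n. span_lo (Lampstand (finsert (- int n) (lit f)) (pos f)) g = - int n \<and>
     span_hi (Lampstand (finsert (- int n) (lit f)) (pos f)) g = span_hi f g) sequentially"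
  using eventually_fset_abs_less[of "lit f"] eventually_fset_abs_less[of "lit g"]
    eventually_abs_less[of "pos f"] eventually_abs_less[of "pos g"]
proof eventually_elim
  case (elim n)
  have f: "- int n < j" "j < int n" if "j |\<in>| lit f" for j
    using bspec[OF elim(1) that] by simp_all
  have g: "- int n < j" "j < int n" if "j |\<in>| lit g" for j
    using bspec[OF elim(2) that] by simp_all
  have "span_lo (Lampstand (finsert (- int n) (lit f)) (pos f)) g = - int n"
    by (rule span_lo_far_lamp) (use f g elim(3,4) in \<open>simp; fail | force\<close>)+
  moreover have "span_hi (Lampstand (finsert (- int n) (lit f)) (pos f)) g = span_hi f g"
    by (rule span_hi_finsert) (use f g elim(3,4) in force)+
  ultimately show ?case ..
qed

text \<open>Passing from the identity to an unlit stand at \<open>p \<ge> 0\<close> changes no lamp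
  and only replaces 0 by \<open>p\<close> in the minimum, so the left end cannot decrease.\<close>

lemma horo_r_plus_le_horo_s:
  "p \<ge> 0 \<Longrightarrow> horo_r_plus f (Lampstand {||} p) \<le> horo_s (pos f) (Lampstand {||} p)"
proof -
  assume "p \<ge> 0"
  then have "span_lo f \<one>\<^bsub>L2\<^esub> \<le> span_lo f (Lampstand {||} p)"
    using le_span_lo_iff[of "span_lo f \<one>\<^bsub>L2\<^esub>" f "\<one>\<^bsub>L2\<^esub>"]
    unfolding le_span_lo_iff[of _ f "Lampstand {||} p"] by (auto simp: one_L2)
  then show ?thesis
    by (simp add: horo_r_plus_span)
qed

lemma eventually_embedding_horo_r_plus:
  "eventually (\<lambda>n. horo_embedding (word_dist L2 gens) \<one>\<^bsub>L2\<^esub>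
     (Lampstand (finsert (int n) (lit f)) (pos f)) g = horo_r_plus f g) sequentially"
  using eventually_span_far_right[of f g] eventually_span_far_right[of f "\<one>\<^bsub>L2\<^esub>"]
  by eventually_elim (simp add: horo_embedding_L2 horo_r_plus_span)

lemma horo_r_plus_unbounded: "\<exists>g. horo_r_plus f g < - real N"
  using horo_s_unbounded(1) horo_r_plus_le_horo_s by (meson le_less_trans)

text \<open>Mirror image: replacing 0 by \<open>p \<le> 0\<close> cannot raise the right
  end.\<close>

lemma horo_r_minus_le_horo_s:
  "p \<le> 0 \<Longrightarrow> horo_r_minus f (Lampstand {||} p) \<le> horo_s (pos f) (Lampstand {||} p)"
proof -
  assume "p \<le> 0"
  then have "span_hi f (Lampstand {||} p) \<le> span_hi f \<one>\<^bsub>L2\<^esub>"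
    using span_hi_le_iff[of f "\<one>\<^bsub>L2\<^esub>" "span_hi f \<one>\<^bsub>L2\<^esub>"]
    unfolding span_hi_le_iff[of f "Lampstand {||} p"] by (auto simp: one_L2)
  then show ?thesis
    by (simp add: horo_r_minus_span)
qed

lemma eventually_embedding_horo_r_minus:
  "eventually (\<lambda>n. horo_embedding (word_dist L2 gens) \<one>\<^bsub>L2\<^esub>
     (Lampstand (finsert (- int n) (lit f)) (pos f)) g = horo_r_minus f g) sequentially"
  using eventually_span_far_left[of f g] eventually_span_far_left[of f "\<one>\<^bsub>L2\<^esub>"]
  by eventually_elim (simp add: horo_embedding_L2 horo_r_minus_span)

lemma horo_r_minus_unbounded: "\<exists>g. horo_r_minus f g < - real N"
  using horo_s_unbounded(2) horo_r_minus_le_horo_s by (meson le_less_trans)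

section \<open>Convergence\<close>

text \<open>Once the leftmost lamp \<open>k\<close> of \<open>f n\<close> lies to the left of 0,
  \<open>l\<close>, \<open>pos g\<close> and all lamps of \<open>g\<close>, the left ends for
  \<open>g\<close> and for the identity both equal \<open>k\<close> and cancel.\<close>

lemma eventually_horo_r_plus_eq_horo_s:
  assumes pos: "\<And>n. pos (f n) = l" and lim: "(\<lambda>n. min_lit (f n)) \<longlonglongrightarrow> - \<infinity>"
  shows "eventually (\<lambda>n. horo_r_plus (f n) g = horo_s l g) sequentially"
proof -
  have "eventually (\<lambda>N. (\<forall>k\<in>fset (lit g). \<bar>k\<bar> < int N) \<and> \<bar>l\<bar> < int N \<and> \<bar>pos g\<bar> < int N) sequentially"
    by (intro eventually_conj eventually_fset_abs_less eventually_abs_less)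
  then obtain N where gN: "\<forall>k\<in>fset (lit g). \<bar>k\<bar> < int N" and N: "\<bar>l\<bar> < int N" "\<bar>pos g\<bar> < int N"
    using eventually_happens'[OF sequentially_bot] by blast
  then have g: "- int N < j" "j < int N" if "j |\<in>| lit g" for j
    using bspec[OF gN that] by simp_all
  have "eventually (\<lambda>n. min_lit (f n) < ereal (real_of_int (- int N))) sequentially"
    using lim by (rule order_tendstoD) simp
  then show ?thesis
  proof eventually_elim
    case (elim n)
    \<comment> \<open>If no lamp were lit, \<open>min_lit\<close> would be
      \<open>\<infinity>\<close>, against the bound; so the minimum \<open>k\<close> is a genuine
      lamp.\<close>
    define k where "k = fMin (lit (f n))"
    have ne: "lit (f n) \<noteq> {||}"
      using elim by (auto simp: min_lit_def min_pos_def)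
    then have k: "k < - int N"
      using elim by (simp add: min_lit_def min_pos_def k_def)
    have mem: "k |\<in>| lit (f n)"
      using ne by (simp add: k_def)
    have ext: "k \<le> j" if "j |\<in>| lit (f n)" for j
      using that by (simp add: k_def)
    have "k \<le> pos (f n)"
      using k N(1) by (simp add: pos abs_less_iff)
    then have far: "span_lo (f n) h = k" if "\<And>j. j |\<in>| lit h \<Longrightarrow> k < j" "k \<le> pos h" for h
      using mem ext that by (intro span_lo_far_lamp)
    have "span_lo (f n) g = k"
    proof (rule far)
      show "k < j" if "j |\<in>| lit g" for j
        using g[OF that] k by linarith
    qed (use k N in linarith)
    moreover have "span_lo (f n) \<one>\<^bsub>L2\<^esub> = k"
      by (rule far) (use k in \<open>simp_all add: one_L2\<close>)
    ultimately show ?case by (simp add: horo_r_plus_span pos)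
  qed
qed

lemma eventually_horo_r_minus_eq_horo_s:
  assumes pos: "\<And>n. pos (f n) = l" and lim: "(\<lambda>n. max_lit (f n)) \<longlonglongrightarrow> \<infinity>"
  shows "eventually (\<lambda>n. horo_r_minus (f n) g = horo_s l g) sequentially"
proof -
  have "eventually (\<lambda>N. (\<forall>k\<in>fset (lit g). \<bar>k\<bar> < int N) \<and> \<bar>l\<bar> < int N \<and> \<bar>pos g\<bar> < int N) sequentially"
    by (intro eventually_conj eventually_fset_abs_less eventually_abs_less)
  then obtain N where gN: "\<forall>k\<in>fset (lit g). \<bar>k\<bar> < int N" and N: "\<bar>l\<bar> < int N" "\<bar>pos g\<bar> < int N"
    using eventually_happens'[OF sequentially_bot] by blast
  then have g: "- int N < j" "j < int N" if "j |\<in>| lit g" for j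
    using bspec[OF gN that] by simp_all
  have "eventually (\<lambda>n. ereal (real_of_int (int N)) < max_lit (f n)) sequentially"
    using lim by (rule order_tendstoD) simp
  then show ?thesis
  proof eventually_elim
    case (elim n)
    define k where "k = fMax (lit (f n))"
    have ne: "lit (f n) \<noteq> {||}"
      using elim by (auto simp: max_lit_def max_pos_def)
    then have k: "int N < k"
      using elim by (simp add: max_lit_def max_pos_def k_def)
    have mem: "k |\<in>| lit (f n)"
      using ne by (simp add: k_def)
    have ext: "j \<le> k" if "j |\<in>| lit (f n)" for j
      using that by (simp add: k_def)
    have "pos (f n) \<le> k"
      using k N(1) by (simp add: pos abs_less_iff)
    then have far: "span_hi (f n) h = k + 1" if "\<And>j. j |\<in>| lit h \<Longrightarrow> j < k" "pos h \<le> k" for h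
      using mem ext that by (intro span_hi_far_lamp)
    have "span_hi (f n) g = k + 1"
    proof (rule far)
      show "j < k" if "j |\<in>| lit g" for j
        using g[OF that] k by linarith
    qed (use k N in linarith)
    moreover have "span_hi (f n) \<one>\<^bsub>L2\<^esub> = k + 1"
      by (rule far) (use k in \<open>simp_all add: one_L2\<close>)
    ultimately show ?case by (simp add: horo_r_minus_span pos)
  qed
qed

theorem mainTheorem7:
  fixes l :: int
  shows "(\<forall>f :: nat \<Rightarrow> lampstand.
            (\<forall>n. max_lit (f n) < ereal (real_of_int (pos (f n))) \<and> pos (f n) = l) \<longrightarrow>
            ((\<lambda>n. min_lit (f n)) \<longlongrightarrow> - \<infinity>) sequentially \<longrightarrow>
            limitin (top_of_set boundary_L2) (\<lambda>n. horo_r_plus (f n)) (horo_s l) sequentially) \<and>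
         (\<forall>f :: nat \<Rightarrow> lampstand.
            (\<forall>n. min_lit (f n) \<ge> ereal (real_of_int (pos (f n))) \<and> pos (f n) = l) \<longrightarrow>
            ((\<lambda>n. max_lit (f n)) \<longlongrightarrow> \<infinity>) sequentially \<longrightarrow>
            limitin (top_of_set boundary_L2) (\<lambda>n. horo_r_minus (f n)) (horo_s l) sequentially)"
proof -
  let ?E = "horo_embedding (word_dist L2 gens) \<one>\<^bsub>L2\<^esub>"
  \<comment> \<open>The topology on functions is the product topology, so eventual equality at each
    point suffices, with no uniformity in \<open>g\<close>.\<close>
  have tendsto: "\<psi> \<longlonglongrightarrow> \<phi>" if "\<And>g. eventually (\<lambda>n. \<psi> n g = \<phi> g) sequentially"
    for \<psi> :: "nat \<Rightarrow> lampstand \<Rightarrow> real" and \<phi>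
  proof -
    have "limitin (product_topology (\<lambda>_. euclidean) UNIV) \<psi> \<phi> sequentially"
      unfolding limitin_componentwise using that by (auto intro: tendsto_eventually)
    then show ?thesis by (simp add: euclidean_product_topology)
  qed
  have boundary: "\<phi> \<in> boundary_L2"
    if lim: "\<And>g. eventually (\<lambda>n. ?E (z n) g = \<phi> g) sequentially"
      and unbounded: "\<And>N. \<exists>g. \<phi> g < - real N" for z \<phi>
  proof -
    have "eventually (\<lambda>n. ?E (z n) \<in> closure (range ?E)) sequentially"
      by (intro always_eventually allI subsetD[OF closure_subset] rangeI)
    then have "\<phi> \<in> closure (range ?E)"
      using tendsto[OF lim] by (intro Lim_in_closed_set[OF closed_closure _ sequentially_bot])
    moreover have "\<phi> \<noteq> ?E f" for f
    proof
      assume f: "\<phi> = ?E f"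
      \<comment> \<open>Distances are nonnegative, so \<open>?E f\<close> is bounded below by minus
        the distance from \<open>f\<close> to the identity, which an unbounded \<open>\<phi>\<close>
        violates.\<close>
      obtain g where "\<phi> g < - real (word_length L2 gens (inv\<^bsub>L2\<^esub> f \<otimes>\<^bsub>L2\<^esub> \<one>\<^bsub>L2\<^esub>))"
        using unbounded by blast
      then show False
        by (simp add: f horo_embedding_def word_dist_def)
    qed
    ultimately show ?thesis
      unfolding boundary_L2_def horo_boundary_def by blast
  qed
  have "\<exists>g. horo_s l g < - real N" for N
    using horo_s_unbounded(1) by blast
  with eventually_embedding_horo_s have "horo_s l \<in> boundary_L2"
    by (rule boundary)
  moreover have "horo_r_plus f \<in> boundary_L2" for f
    using eventually_embedding_horo_r_plus horo_r_plus_unbounded by (rule boundary)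
  moreover have "horo_r_minus f \<in> boundary_L2" for f
    using eventually_embedding_horo_r_minus horo_r_minus_unbounded by (rule boundary)
  \<comment> \<open>Convergence in the subspace requires the limit and the terms to lie in
    \<open>boundary_L2\<close>, beyond pointwise convergence.\<close>
  ultimately show ?thesis
    by (simp add: limitin_subtopology tendsto
        eventually_horo_r_plus_eq_horo_s eventually_horo_r_minus_eq_horo_s)
qed

end
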